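(* Let $G$ be a finite simple connected graph with at least one edge, with maximum degree $\Delta$ and minimum degree $\delta$. Then $$\frac{\delta}{\sqrt{2}}\,R(G) \le DSO(G) \le \frac{\Delta}{\sqrt{2}}\,R(G).$$ For each of the two bounds, equality holds if and only if $G$ is regular.
   Context: For a finite simple graph $G=(V(G),E(G))$, $d_u$ denotes the degree of the vertex $u$. The Diminished Sombor index is $DSO(G)=\sum_{uv\in E(G)}\frac{\sqrt{d_u^2+d_v^2}}{d_u+d_v}$. The Randić index is $R(G)=\sum_{uv\in E(G)} \frac{1}{\sqrt{d_u d_v}}$. *)

theory Defs
  imports Complex_Main "Graph_Theory.Graph_Theory"
begin

text \<open>
  Finite simple graphs are the symmetric digraphs of the locale \<open>graph\<close>: every undirected
  edge \<open>uv\<close> is a pair of opposite arcs. Hence the degree of a vertex is its out-degree, and sums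
  over \<open>E(G)\<close> range over the two-element sets \<open>{u, v}\<close> rather than over arcs, so that each edge
  is counted once.
\<close>

definition edges :: "('a, 'b) pre_digraph \<Rightarrow> 'a set set" where
  "edges G = (\<lambda>a. {tail G a, head G a}) ` arcs G"

abbreviation degree :: "('a, 'b) pre_digraph \<Rightarrow> 'a \<Rightarrow> nat" where
  "degree G v \<equiv> out_degree G v"

definition max_degree :: "('a, 'b) pre_digraph \<Rightarrow> nat" where
  "max_degree G = Max (degree G ` verts G)"

definition min_degree :: "('a, 'b) pre_digraph \<Rightarrow> nat" where
  "min_degree G = Min (degree G ` verts G)"

definition regular :: "('a, 'b) pre_digraph \<Rightarrow> bool" where
  "regular G \<longleftrightarrow> (\<exists>r. \<forall>v \<in> verts G. degree G v = r)"

text \<open>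
  For an edge \<open>e = {u, v}\<close> with \<open>u \<noteq> v\<close>, sums and products over \<open>w \<in> e\<close> are the symmetric
  expressions in the two endpoints; \<open>edge_terms\<close> below spells this out.
\<close>

definition diminished_sombor :: "('a, 'b) pre_digraph \<Rightarrow> real" where
  "diminished_sombor G =
     (\<Sum>e \<in> edges G. sqrt (\<Sum>w \<in> e. (real (degree G w))\<^sup>2) / (\<Sum>w \<in> e. real (degree G w)))"

definition randic :: "('a, 'b) pre_digraph \<Rightarrow> real" where
  "randic G = (\<Sum>e \<in> edges G. 1 / sqrt (\<Prod>w \<in> e. real (degree G w)))"

lemma edge_terms:
  fixes d :: "'a \<Rightarrow> real"
  assumes "u \<noteq> v"
  shows "sqrt (\<Sum>w \<in> {u, v}. (d w)\<^sup>2) / (\<Sum>w \<in> {u, v}. d w) = sqrt ((d u)\<^sup>2 + (d v)\<^sup>2) / (d u + d v)"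
    and "1 / sqrt (\<Prod>w \<in> {u, v}. d w) = 1 / sqrt (d u * d v)"
  using assms by simp_all

end

theory Submission
  imports Defs
begin

text \<open>
  Write \<open>a\<close> and \<open>b\<close> for the degrees at the ends of an edge, and
  \<open>M a b = sqrt (2 a b (a\<^sup>2 + b\<^sup>2)) / (a + b)\<close>. The summand of the diminished Sombor index is
  \<open>M a b / sqrt 2\<close> times the summand \<open>1 / sqrt (a b)\<close> of the Randic index. The point is that
  \<open>M\<close> is a mean: it equals \<open>GM \<cdot> QM / AM\<close> for the geometric, quadratic and arithmetic means of
  \<open>a\<close> and \<open>b\<close>, so \<open>GM \<le> AM \<le> QM\<close> gives \<open>GM \<le> M \<le> QM\<close>. Hence \<open>M a b\<close> lies between any
  lower bound and any upper bound of \<open>a\<close> and \<open>b\<close>, and reaches such a bound only if \<open>a\<close> and \<open>b\<close>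
  both do (\<open>sombor_mean_lower\<close>, \<open>sombor_mean_upper\<close>).

  With the extreme degrees as bounds, both inequalities hold edge by edge, and equality of the
  sums forces equality on every edge, so every endpoint of an edge has the extreme degree.
  Connectedness enters only here: together with the existence of an edge it makes every
  vertex an endpoint (\<open>Union_edges\<close>), and the graph is regular.
\<close>

section \<open>The mean relating the two summands\<close>

definition sombor_mean :: "real \<Rightarrow> real \<Rightarrow> real" where
  "sombor_mean a b = sqrt (2 * (a * b) * (a\<^sup>2 + b\<^sup>2)) / (a + b)"

lemma sombor_term_eq:
  assumes "0 < a" "0 < b"
  shows "sqrt (a\<^sup>2 + b\<^sup>2) / (a + b) = sombor_mean a b / sqrt 2 * (1 / sqrt (a * b))"
proof -
  have "sqrt (2 * (a * b) * (a\<^sup>2 + b\<^sup>2)) = sqrt 2 * sqrt (a * b) * sqrt (a\<^sup>2 + b\<^sup>2)"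
    by (simp only: real_sqrt_mult)
  then show ?thesis
    using assms by (simp add: sombor_mean_def real_sqrt_mult)
qed

text \<open>The factor \<open>QM / AM\<close> is at least 1.\<close>

lemma geometric_mean_le_sombor_mean:
  assumes "0 < a" "0 < b"
  shows "sqrt (a * b) \<le> sombor_mean a b"
proof -
  have "(a + b)\<^sup>2 \<le> 2 * (a\<^sup>2 + b\<^sup>2)"
    using zero_le_power2[of "a - b"] by (simp add: power2_eq_square algebra_simps)
  then have "a + b \<le> sqrt (2 * (a\<^sup>2 + b\<^sup>2))"
    by (rule real_le_rsqrt)
  then have "sqrt (a * b) * (a + b) \<le> sqrt (a * b) * sqrt (2 * (a\<^sup>2 + b\<^sup>2))"
    using assms by (intro mult_left_mono) auto
  also have "\<dots> = sqrt (2 * (a * b) * (a\<^sup>2 + b\<^sup>2))"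
    by (simp only: real_sqrt_mult ac_simps)
  finally show ?thesis
    using assms by (simp add: sombor_mean_def pos_le_divide_eq)
qed

text \<open>The factor \<open>GM / AM\<close> is at most 1.\<close>

lemma sombor_mean_le_quadratic_mean:
  assumes "0 < a" "0 < b"
  shows "sombor_mean a b \<le> sqrt ((a\<^sup>2 + b\<^sup>2) / 2)"
proof -
  have "sqrt (2 * (a * b) * (a\<^sup>2 + b\<^sup>2)) = sqrt (4 * (a * b) * ((a\<^sup>2 + b\<^sup>2) / 2))"
    by simp
  also have "\<dots> = 2 * sqrt (a * b) * sqrt ((a\<^sup>2 + b\<^sup>2) / 2)"
    by (simp only: real_sqrt_mult real_sqrt_four)
  also have "\<dots> \<le> (a + b) * sqrt ((a\<^sup>2 + b\<^sup>2) / 2)"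
    using arith_geo_mean_sqrt[of a b] assms by (intro mult_right_mono) auto
  finally show ?thesis
    using assms by (simp add: sombor_mean_def pos_divide_le_eq mult.commute)
qed

lemma sombor_mean_same:
  assumes "0 < a"
  shows "sombor_mean a a = a"
proof -
  have "2 * (a * a) * (a\<^sup>2 + a\<^sup>2) = (2 * a\<^sup>2)\<^sup>2"
    by (simp add: power2_eq_square)
  then have "sqrt (2 * (a * a) * (a\<^sup>2 + a\<^sup>2)) = 2 * a\<^sup>2"
    by (simp only: real_sqrt_abs) simp
  then show ?thesis
    using assms by (simp only: sombor_mean_def) (simp add: power2_eq_square)
qed

lemma sombor_mean_lower:
  assumes "0 < a" "0 < b" "0 \<le> m" "m \<le> a" "m \<le> b"
  shows "m \<le> sombor_mean a b" and "sombor_mean a b = m \<longleftrightarrow> a = m \<and> b = m"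
proof -
  have m_gm: "m \<le> sqrt (a * b)"
    using assms by (intro real_le_rsqrt) (simp add: power2_eq_square mult_mono)
  show "m \<le> sombor_mean a b"
    using m_gm geometric_mean_le_sombor_mean[OF assms(1,2)] by linarith
  show "sombor_mean a b = m \<longleftrightarrow> a = m \<and> b = m"
  proof
    assume "sombor_mean a b = m"
    then have "sqrt (a * b) = m"
      using m_gm geometric_mean_le_sombor_mean[OF assms(1,2)] by linarith
    then have ab: "a * b = m * m"
      using assms by (metis less_imp_le mult_nonneg_nonneg real_sqrt_mult_self abs_of_nonneg)
    then have "0 < m"
      using assms by (metis less_le mult_pos_pos mult_zero_left)
    have "m * b \<le> m * m" "a * m \<le> m * m"
      using assms ab mult_right_mono[of m a b] mult_left_mono[of m b a] by linarith+
    with \<open>0 < m\<close> assms show "a = m \<and> b = m"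
      by auto
  qed (use assms sombor_mean_same in auto)
qed

lemma sombor_mean_upper:
  assumes "0 < a" "0 < b" "a \<le> m" "b \<le> m"
  shows "sombor_mean a b \<le> m" and "sombor_mean a b = m \<longleftrightarrow> a = m \<and> b = m"
proof -
  have squares: "a\<^sup>2 \<le> m\<^sup>2" "b\<^sup>2 \<le> m\<^sup>2"
    using assms by (auto intro: power_mono)
  then have "(a\<^sup>2 + b\<^sup>2) / 2 \<le> m\<^sup>2"
    by argo
  then have qm_m: "sqrt ((a\<^sup>2 + b\<^sup>2) / 2) \<le> m"
    using assms by (intro real_le_lsqrt) auto
  show "sombor_mean a b \<le> m"
    using qm_m sombor_mean_le_quadratic_mean[OF assms(1,2)] by linarith
  show "sombor_mean a b = m \<longleftrightarrow> a = m \<and> b = m"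
  proof
    assume "sombor_mean a b = m"
    then have "sqrt ((a\<^sup>2 + b\<^sup>2) / 2) = m"
      using qm_m sombor_mean_le_quadratic_mean[OF assms(1,2)] by linarith
    then have "(a\<^sup>2 + b\<^sup>2) / 2 = m\<^sup>2"
      by (metis add_nonneg_nonneg divide_nonneg_nonneg real_sqrt_pow2 zero_le_numeral zero_le_power2)
    then have "a\<^sup>2 = m\<^sup>2" "b\<^sup>2 = m\<^sup>2"
      using squares by auto
    then show "a = m \<and> b = m"
      using assms by (simp add: power2_eq_iff)
  qed (use assms sombor_mean_same in auto)
qed

section \<open>Edges and degrees\<close>

lemma (in graph) edge_endpoints:
  assumes "e \<in> edges G"
  obtains u v where "e = {u, v}" "u \<noteq> v" "u \<in> verts G" "v \<in> verts G"
    "0 < degree G u" "0 < degree G v"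
proof -
  obtain a where a: "a \<in> arcs G" "e = {tail G a, head G a}"
    using assms by (auto simp: edges_def)
  \<comment> \<open>Degrees count outgoing arcs, so the head needs the reversed arc.\<close>
  obtain b where b: "b \<in> arcs G" "tail G b = head G a"
    using sym_arcs a(1) by (fastforce simp: symmetric_conv)
  have pos: "0 < degree G (tail G c)" if "c \<in> arcs G" for c
    using that by (auto simp: out_degree_def card_gt_0_iff)
  show thesis
    using that[OF a(2)] no_loops[OF a(1)] pos[OF a(1)] pos[OF b(1)] a b by simp
qed

lemma (in graph) Union_edges:
  assumes "Digraph_Component.connected G" "arcs G \<noteq> {}"
  shows "\<Union> (edges G) = verts G"
proof (intro equalityI subsetI)
  fix v assume v: "v \<in> verts G"
  obtain a where a: "a \<in> arcs G"
    using assms(2) by blast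
  \<comment> \<open>An arc has two distinct ends, so some vertex other than \<open>v\<close> is reachable from \<open>v\<close>.\<close>
  obtain w where w: "w \<in> verts G" "w \<noteq> v"
    using no_loops[OF a] a by (metis tail_in_verts head_in_verts)
  have "v \<rightarrow>\<^sup>* w"
    using symmetric_connected_imp_strongly_connected[OF sym_arcs assms(1)] v w(1)
    by (auto simp: strongly_connected_def)
  then obtain x where "v \<rightarrow> x"
    using w(2) by (cases rule: converse_reachable_cases) auto
  then show "v \<in> \<Union> (edges G)"
    by (auto simp: edges_def arcs_ends_conv)
qed (auto simp: edges_def)

lemma (in fin_digraph) min_degree_le: "v \<in> verts G \<Longrightarrow> min_degree G \<le> degree G v"
  by (simp add: min_degree_def)

lemma (in fin_digraph) le_max_degree: "v \<in> verts G \<Longrightarrow> degree G v \<le> max_degree G"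
  by (simp add: max_degree_def)

lemma regular_iff_min_degree:
  assumes "verts G \<noteq> {}"
  shows "regular G \<longleftrightarrow> (\<forall>v \<in> verts G. degree G v = min_degree G)"
  using assms by (auto simp: regular_def min_degree_def image_constant_conv cong: image_cong_simp)

lemma regular_iff_max_degree:
  assumes "verts G \<noteq> {}"
  shows "regular G \<longleftrightarrow> (\<forall>v \<in> verts G. degree G v = max_degree G)"
  using assms by (auto simp: regular_def max_degree_def image_constant_conv cong: image_cong_simp)

section \<open>The bounds on a single edge and their sum\<close>

lemma (in graph) edge_bounds:
  fixes s r :: "'a set \<Rightarrow> real"
  defines "s \<equiv> \<lambda>e. sqrt (\<Sum>w \<in> e. (real (degree G w))\<^sup>2) / (\<Sum>w \<in> e. real (degree G w))"
    and "r \<equiv> \<lambda>e. 1 / sqrt (\<Prod>w \<in> e. real (degree G w))"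
  assumes e: "e \<in> edges G"
  shows "real (min_degree G) / sqrt 2 * r e \<le> s e"
    and "real (min_degree G) / sqrt 2 * r e = s e \<longleftrightarrow>
      (\<forall>v \<in> e. degree G v = min_degree G)"
    and "s e \<le> real (max_degree G) / sqrt 2 * r e"
    and "s e = real (max_degree G) / sqrt 2 * r e \<longleftrightarrow>
      (\<forall>v \<in> e. degree G v = max_degree G)"
proof -
  obtain u v where uv: "e = {u, v}" "u \<noteq> v" "u \<in> verts G" "v \<in> verts G"
      "0 < degree G u" "0 < degree G v"
    using e by (rule edge_endpoints)
  define M where "M = sombor_mean (degree G u) (degree G v)"
  have pos: "0 < r e"
    using uv by (simp add: r_def)
  have eq: "s e = M / sqrt 2 * r e"
    using sombor_term_eq[of "degree G u" "degree G v"] uv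
    by (simp add: s_def r_def M_def)
  have scale: "x / sqrt 2 * r e \<le> y / sqrt 2 * r e \<longleftrightarrow> x \<le> y"
      "x / sqrt 2 * r e = y / sqrt 2 * r e \<longleftrightarrow> x = y" for x y
    using pos by (auto simp: divide_le_cancel)
  note lower = sombor_mean_lower[of "degree G u" "degree G v" "min_degree G"]
  note upper = sombor_mean_upper[of "degree G u" "degree G v" "max_degree G"]
  show "real (min_degree G) / sqrt 2 * r e \<le> s e"
    unfolding eq scale using lower(1) uv by (simp add: M_def min_degree_le)
  show "s e \<le> real (max_degree G) / sqrt 2 * r e"
    unfolding eq scale using upper(1) uv by (simp add: M_def le_max_degree)
  show "real (min_degree G) / sqrt 2 * r e = s e \<longleftrightarrow> (\<forall>v \<in> e. degree G v = min_degree G)"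
    unfolding eq scale eq_commute[of "real (min_degree G)"]
    using lower(2) uv by (simp add: M_def min_degree_le)
  show "s e = real (max_degree G) / sqrt 2 * r e \<longleftrightarrow> (\<forall>v \<in> e. degree G v = max_degree G)"
    unfolding eq scale using upper(2) uv by (simp add: M_def le_max_degree)
qed

lemma sum_eq_iff_of_le:
  fixes f g :: "'i \<Rightarrow> real"
  assumes "finite I" "\<And>i. i \<in> I \<Longrightarrow> f i \<le> g i"
  shows "sum f I = sum g I \<longleftrightarrow> (\<forall>i \<in> I. f i = g i)"
  using assms sum_mono_inv[of f I g] by (auto intro: sum.cong)

theorem theorem4:
  fixes G :: "('a, 'b) pre_digraph"
  assumes "graph G"
    and "Digraph_Component.connected G"
    and "arcs G \<noteq> {}"
  shows "real (min_degree G) / sqrt 2 * randic G \<le> diminished_sombor G \<and>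
    diminished_sombor G \<le> real (max_degree G) / sqrt 2 * randic G \<and>
    (real (min_degree G) / sqrt 2 * randic G = diminished_sombor G \<longleftrightarrow> regular G) \<and>
    (diminished_sombor G = real (max_degree G) / sqrt 2 * randic G \<longleftrightarrow> regular G)"
proof -
  interpret graph G by fact
  have fin: "finite (edges G)"
    by (simp add: edges_def)
  have cover: "\<Union> (edges G) = verts G"
    using assms(2,3) by (rule Union_edges)
  have nonempty: "verts G \<noteq> {}"
    using assms(3) tail_in_verts by blast
  have on_verts: "(\<forall>e \<in> edges G. \<forall>v \<in> e. P v) \<longleftrightarrow> (\<forall>v \<in> verts G. P v)" for P
    using cover by blast
  note sums = diminished_sombor_def randic_def sum_distrib_left
  have lower: "real (min_degree G) / sqrt 2 * randic G \<le> diminished_sombor G"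
    unfolding sums by (intro sum_mono edge_bounds)
  have upper: "diminished_sombor G \<le> real (max_degree G) / sqrt 2 * randic G"
    unfolding sums by (intro sum_mono edge_bounds)
  have lower_eq: "real (min_degree G) / sqrt 2 * randic G = diminished_sombor G \<longleftrightarrow> regular G"
    unfolding sums
    by (simp only: sum_eq_iff_of_le[OF fin] edge_bounds on_verts
        regular_iff_min_degree[OF nonempty] cong: ball_cong)
  have upper_eq: "diminished_sombor G = real (max_degree G) / sqrt 2 * randic G \<longleftrightarrow> regular G"
    unfolding sums
    by (simp only: sum_eq_iff_of_le[OF fin] edge_bounds on_verts
        regular_iff_max_degree[OF nonempty] cong: ball_cong)
  show ?thesis
    using lower upper lower_eq upper_eq by blast
qed

end
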